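(* Let $X$ and $Y$ be finite sets of sizes $m\ge 1$ and $n\ge 1$, respectively. The number of eventually constant pairs of maps $(f,g)$, with $f:X\to Y$ and $g:Y\to X$, is $$m^{n-1}\, n^{m-1}\,(m+n-1).$$
   Context: For maps $f:X\to Y$ and $g:Y\to X$, the pair $(f,g)$ is called an eventually constant pair if the composition $gf:X\to X$ is eventually constant, i.e. there is an integer $k>0$ such that the $k$-fold composite $(gf)^k = gf\circ\cdots\circ gf$ is a constant map. (Equivalently, $fg$ is eventually constant.) *)

theory Defs
  imports "HOL-Analysis.Analysis"
begin

text \<open>
  A map from \<open>X\<close> to \<open>Y\<close> is an element of \<open>X \<rightarrow>\<^sub>E Y\<close>, so that distinct elements of this set are
  distinct maps. The iterates below are taken of total functions; for a self-map \<open>h\<close> of \<open>X\<close>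
  the iterates agree on \<open>X\<close> with the iterates of the map \<open>h\<close> from \<open>X\<close> to \<open>X\<close>, and
  \<open>constant_on\<close> only inspects their values there.
\<close>

definition eventually_constant_on :: "('a \<Rightarrow> 'a) \<Rightarrow> 'a set \<Rightarrow> bool" where
  "eventually_constant_on h X \<longleftrightarrow> (\<exists>k>0. (h ^^ k) constant_on X)"

definition eventually_constant_pair :: "'a set \<Rightarrow> 'b set \<Rightarrow> ('a \<Rightarrow> 'b) \<Rightarrow> ('b \<Rightarrow> 'a) \<Rightarrow> bool" where
  "eventually_constant_pair X Y f g \<longleftrightarrow>
     f \<in> X \<rightarrow>\<^sub>E Y \<and> g \<in> Y \<rightarrow>\<^sub>E X \<and> eventually_constant_on (g \<circ> f) X"

end

theory Submission
  imports Defs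
begin

text \<open>
  Draw \<open>f\<close> and \<open>g\<close> together as arrows on the disjoint union of \<open>X\<close> and \<open>Y\<close>. The composition
  \<open>g \<circ> f\<close> is eventually constant exactly when this functional graph has a single cycle and that
  cycle has length two, \<open>x \<rightarrow> y \<rightarrow> x\<close>; here \<open>x\<close> is the eventual value and \<open>y = f x\<close>. Cutting at
  this cycle turns the pair into a forest of arrows between \<open>X - {x}\<close> and \<open>Y - {y}\<close> in which every
  path ends at one of the roots \<open>x\<close>, \<open>y\<close>, and every such forest arises once
  (\<open>card_terminal_edge\<close>). So it suffices to count bipartite forests with given roots.

  For \<open>p\<close> and \<open>q\<close> non-root vertices and \<open>a\<close> and \<open>b\<close> roots on the two sides, let \<open>F\<close> be the number
  of forests. Theorem \<open>card_forests\<close> states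
  \<open>(p + a) * (q + b) * F = (p + a) ^ q * (q + b) ^ p * (a * q + b * p + a * b)\<close>.
  For \<open>a = b = 1\<close>, \<open>p = m - 1\<close>, \<open>q = n - 1\<close> the left side is \<open>m * n * F\<close>, which is the sum of \<open>F\<close>
  over all \<open>m * n\<close> choices of the cycle, and the right side is the claimed number.

  The forests are counted by peeling off one layer (\<open>card_forests_layer\<close>): sort them by the set \<open>I\<close>
  of those vertices of the first side that point directly at a root. Each of these chooses its root
  freely, and it then serves as a root for what is left. This removes all roots of the second side.
  When roots remain on one side only, peeling again from that side leaves a forest whose roots lie
  on the other side only, with fewer vertices, so induction applies; the sum over \<open>I\<close> is in each
  case a binomial sum or its derivative.
\<close>

section \<open>Binomial sums over subsets\<close>

lemma sum_Pow_insert: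
  fixes F :: "'a set \<Rightarrow> nat"
  assumes "finite P" "x \<notin> P"
  shows "(\<Sum>I\<in>Pow (insert x P). F I) = (\<Sum>I\<in>Pow P. F I) + (\<Sum>I\<in>Pow P. F (insert x I))"
proof -
  have "inj_on (insert x) (Pow P)"
    using assms(2) by (auto simp: inj_on_def)
  moreover have "Pow P \<inter> insert x ` Pow P = {}"
    using assms(2) by auto
  ultimately show ?thesis
    using assms(1) by (simp add: Pow_insert sum.union_disjoint sum.reindex)
qed

lemma sum_Pow_binomial:
  fixes b q :: nat
  assumes "finite P"
  shows "(\<Sum>I\<in>Pow P. b ^ card I * q ^ card (P - I)) = (b + q) ^ card P"
  using assms
proof (induction P rule: finite_induct)
  case empty
  then show ?case by simp
next
  case (insert x P)
  have "(\<Sum>I\<in>Pow P. b ^ card I * q ^ card (insert x P - I))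
      = (\<Sum>I\<in>Pow P. q * (b ^ card I * q ^ card (P - I)))"
  proof (rule sum.cong)
    fix I assume "I \<in> Pow P"
    then have "insert x P - I = insert x (P - I)" "x \<notin> P - I" "finite (P - I)"
      using insert by auto
    then show "b ^ card I * q ^ card (insert x P - I) = q * (b ^ card I * q ^ card (P - I))"
      by simp
  qed simp
  moreover have "(\<Sum>I\<in>Pow P. b ^ card (insert x I) * q ^ card (insert x P - insert x I))
      = (\<Sum>I\<in>Pow P. b * (b ^ card I * q ^ card (P - I)))"
  proof (rule sum.cong)
    fix I assume "I \<in> Pow P"
    then have "insert x P - insert x I = P - I" "x \<notin> I" "finite I"
      using insert by (auto intro: finite_subset)
    then show "b ^ card (insert x I) * q ^ card (insert x P - insert x I)
      = b * (b ^ card I * q ^ card (P - I))"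
      by simp
  qed simp
  ultimately show ?case
    using insert by (simp add: sum_Pow_insert sum_distrib_left[symmetric] algebra_simps)
qed

text \<open>
  This is the derivative of the binomial theorem in \<open>b\<close>, multiplied by \<open>b * (b + q)\<close>. The extra
  factor \<open>b + q\<close> avoids the exponent \<open>card P - 1\<close>, which would need a separate case for
  empty \<open>P\<close>.
\<close>

lemma sum_Pow_binomial_card:
  fixes b q :: nat
  assumes "finite P"
  shows "(b + q) * (\<Sum>I\<in>Pow P. card I * (b ^ card I * q ^ card (P - I)))
    = card P * b * (b + q) ^ card P"
  using assms
proof (induction P rule: finite_induct)
  case empty
  then show ?case by simp
next
  case (insert x P)
  let ?D = "\<Sum>I\<in>Pow P. card I * (b ^ card I * q ^ card (P - I))"
  have "(\<Sum>I\<in>Pow P. card I * (b ^ card I * q ^ card (insert x P - I)))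
      = (\<Sum>I\<in>Pow P. q * (card I * (b ^ card I * q ^ card (P - I))))"
  proof (rule sum.cong)
    fix I assume "I \<in> Pow P"
    then have "insert x P - I = insert x (P - I)" "x \<notin> P - I" "finite (P - I)"
      using insert by auto
    then show "card I * (b ^ card I * q ^ card (insert x P - I))
      = q * (card I * (b ^ card I * q ^ card (P - I)))"
      by simp
  qed simp
  moreover have "(\<Sum>I\<in>Pow P. card (insert x I) *
        (b ^ card (insert x I) * q ^ card (insert x P - insert x I)))
      = (\<Sum>I\<in>Pow P. b * (card I * (b ^ card I * q ^ card (P - I)))
            + b * (b ^ card I * q ^ card (P - I)))"
  proof (rule sum.cong)
    fix I assume "I \<in> Pow P"
    then have "insert x P - insert x I = P - I" "x \<notin> I" "finite I"
      using insert by (auto intro: finite_subset)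
    then show "card (insert x I) * (b ^ card (insert x I) * q ^ card (insert x P - insert x I))
      = b * (card I * (b ^ card I * q ^ card (P - I))) + b * (b ^ card I * q ^ card (P - I))"
      by (simp add: algebra_simps)
  qed simp
  ultimately have "(\<Sum>I\<in>Pow (insert x P). card I * (b ^ card I * q ^ card (insert x P - I)))
      = q * ?D + (b * ?D + b * (b + q) ^ card P)"
    using insert
    by (simp add: sum_Pow_insert sum.distrib sum_distrib_left[symmetric] sum_Pow_binomial)
  then have "(b + q) * (\<Sum>I\<in>Pow (insert x P). card I * (b ^ card I * q ^ card (insert x P - I)))
      = (b + q) * ((b + q) * ?D) + b * (b + q) * (b + q) ^ card P"
    by (simp add: algebra_simps)
  also have "(b + q) * ?D = card P * b * (b + q) ^ card P"
    by (rule insert.IH)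
  finally show ?case
    using insert(1,2) by (simp add: algebra_simps)
qed

section \<open>Bipartite rooted forests\<close>

text \<open>
  Every path of arrows leaves \<open>P\<close> and \<open>Q\<close> eventually (when these are finite) iff no nonempty part of
  them is closed under both maps. Speaking of closed parts instead of paths makes the condition
  visibly symmetric in the two sides and insensitive to values outside \<open>P\<close> and \<open>Q\<close>.
\<close>

definition trap_free :: "'a set \<Rightarrow> 'b set \<Rightarrow> ('a \<Rightarrow> 'b) \<Rightarrow> ('b \<Rightarrow> 'a) \<Rightarrow> bool" where
  "trap_free P Q f g \<longleftrightarrow>
     (\<forall>V U. V \<subseteq> P \<longrightarrow> U \<subseteq> Q \<longrightarrow> f ` V \<subseteq> U \<longrightarrow> g ` U \<subseteq> V \<longrightarrow> V = {} \<and> U = {})"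

text \<open>
  \<open>P\<close> and \<open>Q\<close> are the non-root vertices of the two sides, \<open>A\<close> and \<open>B\<close> their roots; each non-root
  vertex is mapped to its parent.
\<close>

definition forests ::
  "'a set \<Rightarrow> 'b set \<Rightarrow> 'a set \<Rightarrow> 'b set \<Rightarrow> (('a \<Rightarrow> 'b) \<times> ('b \<Rightarrow> 'a)) set" where
  "forests P Q A B =
     {(f, g). f \<in> P \<rightarrow>\<^sub>E Q \<union> B \<and> g \<in> Q \<rightarrow>\<^sub>E P \<union> A \<and> trap_free P Q f g}"

lemma trap_free_swap: "trap_free P Q f g \<longleftrightarrow> trap_free Q P g f"
  unfolding trap_free_def by metis

lemma trap_free_cong:
  assumes "\<And>x. x \<in> P \<Longrightarrow> f x = f' x" "\<And>y. y \<in> Q \<Longrightarrow> g y = g' y"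
  shows "trap_free P Q f g \<longleftrightarrow> trap_free P Q f' g'"
proof -
  have "f ` V = f' ` V" "g ` U = g' ` U" if "V \<subseteq> P" "U \<subseteq> Q" for V U
    using that assms by (auto intro!: image_cong)
  then show ?thesis
    unfolding trap_free_def by (intro iff_allI imp_cong refl) simp_all
qed

text \<open>
  A vertex whose parent lies outside \<open>Q\<close> belongs to no closed part, so it can be treated as a root.
\<close>

lemma trap_free_Diff:
  assumes "\<And>x. x \<in> I \<Longrightarrow> f x \<notin> Q"
  shows "trap_free P Q f g \<longleftrightarrow> trap_free (P - I) Q f g"
proof -
  have "V \<inter> I = {}" if "f ` V \<subseteq> U" "U \<subseteq> Q" for U V
    using that assms by blast
  then have "V \<subseteq> P \<longleftrightarrow> V \<subseteq> P - I" if "f ` V \<subseteq> U" "U \<subseteq> Q" for U V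
    using that by blast
  then show ?thesis
    unfolding trap_free_def by metis
qed

lemma finite_forests:
  assumes "finite P" "finite Q" "finite A" "finite B"
  shows "finite (forests P Q A B)"
proof (rule finite_subset)
  show "forests P Q A B \<subseteq> (P \<rightarrow>\<^sub>E Q \<union> B) \<times> (Q \<rightarrow>\<^sub>E P \<union> A)"
    by (auto simp: forests_def)
  show "finite ((P \<rightarrow>\<^sub>E Q \<union> B) \<times> (Q \<rightarrow>\<^sub>E P \<union> A))"
    using assms by (intro finite_cartesian_product finite_PiE) auto
qed

lemma card_forests_swap: "card (forests P Q A B) = card (forests Q P B A)"
proof (rule bij_betw_same_card)
  show "bij_betw prod.swap (forests P Q A B) (forests Q P B A)"
    by (rule bij_betw_byWitness[where f' = prod.swap])
       (auto simp: forests_def trap_free_swap[of P Q])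
qed

text \<open>
  If \<open>I\<close> is the set of vertices pointing directly into \<open>B\<close>, the values of \<open>f\<close> on \<open>I\<close> are arbitrary
  elements of \<open>B\<close>, independent of the rest. The rest is a forest in which \<open>I\<close> has joined the roots
  and no arrow goes to \<open>B\<close>.
\<close>

lemma card_forests_fibre:
  assumes "Q \<inter> B = {}" "I \<subseteq> P"
  shows "card {e \<in> forests P Q A B. {x \<in> P. fst e x \<in> B} = I}
    = card (I \<rightarrow>\<^sub>E B) * card (forests (P - I) Q (A \<union> I) {})"
proof -
  let ?S = "{e \<in> forests P Q A B. {x \<in> P. fst e x \<in> B} = I}"
  let ?T = "(I \<rightarrow>\<^sub>E B) \<times> forests (P - I) Q (A \<union> I) {}"
  let ?\<phi> = "\<lambda>(f, g). (restrict f I, (restrict f (P - I), g))"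
  let ?\<psi> = "\<lambda>(u, (f, g)). (\<lambda>x. if x \<in> I then u x else f x, g)"
  have PA: "P - I \<union> (A \<union> I) = P \<union> A"
    using assms(2) by blast
  have "bij_betw ?\<phi> ?S ?T"
  proof (rule bij_betw_byWitness[where f' = ?\<psi>])
    show "\<forall>a\<in>?S. ?\<psi> (?\<phi> a) = a"
      using assms(2) by (auto simp: forests_def fun_eq_iff PiE_def extensional_def)
    show "\<forall>a\<in>?T. ?\<phi> (?\<psi> a) = a"
      by (auto simp: forests_def fun_eq_iff PiE_def extensional_def)
    show "?\<phi> ` ?S \<subseteq> ?T"
    proof (rule image_subsetI)
      fix a assume "a \<in> ?S"
      moreover obtain f g where a: "a = (f, g)"
        by (rule prod.exhaust)
      ultimately have fg: "(f, g) \<in> forests P Q A B" and I: "{x \<in> P. f x \<in> B} = I"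
        by simp_all
      have *: "f \<in> P \<rightarrow>\<^sub>E Q \<union> B" "g \<in> Q \<rightarrow>\<^sub>E P \<union> A" "trap_free P Q f g"
        using fg by (auto simp: forests_def)
      have "trap_free (P - I) Q f g"
        using *(3) assms(1) I by (subst trap_free_Diff[symmetric]) auto
      then have "trap_free (P - I) Q (restrict f (P - I)) g"
        by (subst trap_free_cong[of _ _ f _ _ g]) auto
      moreover have "restrict f (P - I) \<in> P - I \<rightarrow>\<^sub>E Q"
        using *(1) I by (fastforce intro!: restrict_PiE simp: PiE_iff)
      ultimately have "(restrict f (P - I), g) \<in> forests (P - I) Q (A \<union> I) {}"
        using *(2) by (simp add: forests_def PA)
      moreover have "restrict f I \<in> I \<rightarrow>\<^sub>E B"
        using I by auto
      ultimately show "?\<phi> a \<in> ?T"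
        by (simp add: a)
    qed
    show "?\<psi> ` ?T \<subseteq> ?S"
    proof (rule image_subsetI)
      fix a assume "a \<in> ?T"
      then obtain u w where "a = (u, w)" and u: "u \<in> I \<rightarrow>\<^sub>E B"
        and "w \<in> forests (P - I) Q (A \<union> I) {}"
        by (rule SigmaE)
      moreover obtain f g where "w = (f, g)"
        by (rule prod.exhaust)
      ultimately have a: "a = (u, (f, g))" and fg: "(f, g) \<in> forests (P - I) Q (A \<union> I) {}"
        by simp_all
      let ?f = "\<lambda>x. if x \<in> I then u x else f x"
      have *: "f \<in> P - I \<rightarrow>\<^sub>E Q" "g \<in> Q \<rightarrow>\<^sub>E P \<union> A" "trap_free (P - I) Q f g"
        using fg by (auto simp: forests_def PA)
      have "trap_free (P - I) Q ?f g"
        using *(3) by (subst trap_free_cong[of _ _ f _ _ g]) auto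
      then have "trap_free P Q ?f g"
        using assms(1) u by (subst trap_free_Diff[of I]) auto
      moreover have "?f \<in> P \<rightarrow>\<^sub>E Q \<union> B"
        using *(1) u assms(2) by (auto simp: PiE_iff extensional_def)
      moreover have "{x \<in> P. ?f x \<in> B} = I"
        using *(1) u assms by (fastforce simp: PiE_iff)
      ultimately show "?\<psi> a \<in> ?S"
        using *(2) by (simp add: forests_def a)
    qed
  qed
  then have "card ?S = card ?T"
    by (rule bij_betw_same_card)
  then show ?thesis
    by (simp add: card_cartesian_product)
qed

lemma card_forests_layer:
  assumes fin: "finite P" "finite Q" "finite A" "finite B" and "Q \<inter> B = {}"
  shows "card (forests P Q A B)
    = (\<Sum>I\<in>Pow P. card B ^ card I * card (forests (P - I) Q (A \<union> I) {}))"
proof -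
  let ?S = "\<lambda>I. {e \<in> forests P Q A B. {x \<in> P. fst e x \<in> B} = I}"
  have "card (forests P Q A B) = (\<Sum>e\<in>forests P Q A B. 1)"
    by simp
  also have "\<dots> = (\<Sum>I\<in>Pow P. \<Sum>e\<in>?S I. 1)"
    using fin(1) finite_forests[OF fin] by (intro sum.group[symmetric]) auto
  also have "\<dots> = (\<Sum>I\<in>Pow P. card (?S I))"
    by simp
  also have "\<dots> = (\<Sum>I\<in>Pow P. card B ^ card I * card (forests (P - I) Q (A \<union> I) {}))"
  proof (rule sum.cong)
    fix I assume I: "I \<in> Pow P"
    then have "finite I"
      using fin(1) finite_subset by blast
    then have "card (I \<rightarrow>\<^sub>E B) = card B ^ card I"
      by (simp add: card_PiE)
    then show "card (?S I) = card B ^ card I * card (forests (P - I) Q (A \<union> I) {})"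
      using I by (simp only: card_forests_fibre[OF assms(5)] Pow_iff)
  qed simp
  finally show ?thesis .
qed

text \<open>Without roots, \<open>P\<close> and \<open>Q\<close> themselves form a closed part.\<close>

lemma forests_no_roots:
  assumes "P \<noteq> {}"
  shows "forests P Q {} {} = {}"
proof -
  have "\<not> trap_free P Q f g" if "f \<in> P \<rightarrow>\<^sub>E Q" "g \<in> Q \<rightarrow>\<^sub>E P" for f g
    unfolding trap_free_def using that assms by blast
  then show ?thesis
    by (auto simp: forests_def)
qed

text \<open>
  With all roots \<open>A\<close> next to \<open>P\<close>, peel off the set \<open>J\<close> of those vertices of \<open>Q\<close> that point into \<open>A\<close>.
  The remaining forest has its roots \<open>J\<close> on the side of \<open>Q\<close> only, so the same formula with the sides
  exchanged, where \<open>card (Q - J) + card J = card Q\<close>, gives each summand. For \<open>J = {}\<close> the vertex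
  count does not drop, but then there are no roots and no forests. The factor
  \<open>card P + card A\<close> keeps the formula valid when \<open>Q\<close> is empty.
\<close>

lemma card_forests_one_sided_step:
  fixes P :: "'a set" and Q :: "'b set"
  assumes fin: "finite P" "finite Q" "finite A" and disj: "P \<inter> A = {}"
    and IH: "\<And>J. J \<subseteq> Q \<Longrightarrow> J \<noteq> {} \<Longrightarrow>
      card Q * card (forests (Q - J) P J {}) = card J * card P ^ card (Q - J) * card Q ^ card P"
  shows "(card P + card A) * card (forests P Q A {})
    = card A * card Q ^ card P * (card P + card A) ^ card Q"
proof (cases "Q = {}")
  case True
  have "forests P ({} :: 'b set) A {} = (if P = {} then {(\<lambda>_. undefined, \<lambda>_. undefined)} else {})"
    by (auto simp: forests_def trap_free_def)
  then show ?thesis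
    using True fin by (cases "P = {}") auto
next
  case False
  have layer: "card Q * card (forests (Q - J) P J {})
      = card J * card P ^ card (Q - J) * card Q ^ card P" if "J \<subseteq> Q" for J
    using IH[OF that] forests_no_roots[OF False, of P] by (cases "J = {}") auto
  let ?D = "\<Sum>J\<in>Pow Q. card J * (card A ^ card J * card P ^ card (Q - J))"
  have "card Q * card (forests P Q A {})
      = card Q * (\<Sum>J\<in>Pow Q. card A ^ card J * card (forests (Q - J) P J {}))"
    using card_forests_layer[of Q P "{}" A] fin disj by (simp add: card_forests_swap[of P])
  also have "\<dots> = (\<Sum>J\<in>Pow Q. card A ^ card J * (card Q * card (forests (Q - J) P J {})))"
    by (simp add: sum_distrib_left mult.left_commute)
  also have "\<dots> = (\<Sum>J\<in>Pow Q. card Q ^ card P * (card J * (card A ^ card J * card P ^ card (Q - J))))"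
    by (rule sum.cong) (auto simp: layer)
  also have "\<dots> = card Q ^ card P * ?D"
    by (simp add: sum_distrib_left)
  finally have "card Q * ((card P + card A) * card (forests P Q A {}))
      = card Q ^ card P * ((card A + card P) * ?D)"
    by (simp add: algebra_simps)
  also have "\<dots> = card Q * (card A * card Q ^ card P * (card P + card A) ^ card Q)"
    unfolding sum_Pow_binomial_card[OF fin(2)] by (simp add: algebra_simps)
  finally show ?thesis
    using False fin by simp
qed

lemma card_Diff_nonempty_subset:
  assumes "finite R" "J \<subseteq> R" "J \<noteq> {}"
  shows "card (R - J) + card J = card R" and "card (R - J) < card R"
proof -
  show "card (R - J) + card J = card R"
    using assms by (metis card_Diff_subset card_mono finite_subset le_add_diff_inverse2)
  show "card (R - J) < card R"
    using assms by (intro psubset_card_mono) auto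
qed

text \<open>
  Peeling exchanges the two sides, which have different types, so the induction carries the formula
  for both orders of the sides at once.
\<close>

lemma card_forests_one_sided_both:
  "(\<forall>(P :: 'a set) (Q :: 'b set) A. finite P \<longrightarrow> finite Q \<longrightarrow> finite A \<longrightarrow> P \<inter> A = {} \<longrightarrow>
      card P + card Q = k \<longrightarrow>
      (card P + card A) * card (forests P Q A {})
        = card A * card Q ^ card P * (card P + card A) ^ card Q) \<and>
   (\<forall>(Q :: 'b set) (P :: 'a set) B. finite Q \<longrightarrow> finite P \<longrightarrow> finite B \<longrightarrow> Q \<inter> B = {} \<longrightarrow>
      card Q + card P = k \<longrightarrow>
      (card Q + card B) * card (forests Q P B {})
        = card B * card P ^ card Q * (card Q + card B) ^ card P)"
proof (induction k rule: less_induct)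
  case (less k)
  show ?case
  proof (intro conjI allI impI)
    fix P :: "'a set" and Q :: "'b set" and A
    assume *: "finite P" "finite Q" "finite A" "P \<inter> A = {}" "card P + card Q = k"
    show "(card P + card A) * card (forests P Q A {})
        = card A * card Q ^ card P * (card P + card A) ^ card Q"
    proof (rule card_forests_one_sided_step[OF *(1-4)])
      fix J assume J: "J \<subseteq> Q" "J \<noteq> {}"
      have **: "finite J" "finite (Q - J)" "(Q - J) \<inter> J = {}" "card (Q - J) + card P < k"
        using * J card_Diff_nonempty_subset(2)[OF *(2) J] by (auto intro: finite_subset)
      show "card Q * card (forests (Q - J) P J {})
          = card J * card P ^ card (Q - J) * card Q ^ card P"
        using less.IH[OF **(4), THEN conjunct2, rule_format, OF **(2) *(1) **(1,3) refl]
        by (simp only: card_Diff_nonempty_subset(1)[OF *(2) J])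
    qed
  next
    fix Q :: "'b set" and P :: "'a set" and B
    assume *: "finite Q" "finite P" "finite B" "Q \<inter> B = {}" "card Q + card P = k"
    show "(card Q + card B) * card (forests Q P B {})
        = card B * card P ^ card Q * (card Q + card B) ^ card P"
    proof (rule card_forests_one_sided_step[OF *(1-4)])
      fix J assume J: "J \<subseteq> P" "J \<noteq> {}"
      have **: "finite J" "finite (P - J)" "(P - J) \<inter> J = {}" "card (P - J) + card Q < k"
        using * J card_Diff_nonempty_subset(2)[OF *(2) J] by (auto intro: finite_subset)
      show "card P * card (forests (P - J) Q J {})
          = card J * card Q ^ card (P - J) * card P ^ card Q"
        using less.IH[OF **(4), THEN conjunct1, rule_format, OF **(2) *(1) **(1,3) refl]
        by (simp only: card_Diff_nonempty_subset(1)[OF *(2) J])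
    qed
  qed
qed

lemma card_forests_one_sided:
  assumes "finite P" "finite Q" "finite A" "P \<inter> A = {}"
  shows "(card P + card A) * card (forests P Q A {})
    = card A * card Q ^ card P * (card P + card A) ^ card Q"
  using card_forests_one_sided_both[THEN conjunct1, rule_format, OF assms refl] .

text \<open>
  Peeling off the vertices \<open>I\<close> that point into \<open>B\<close> reduces the general case to roots on one side.
  There \<open>card (P - I) + card (A \<union> I) = card P + card A\<close> does not depend on \<open>I\<close>, so the sum over \<open>I\<close>
  splits into \<open>card A\<close> times a binomial sum and its derivative. The factors on the left keep all
  exponents free of subtraction.
\<close>

theorem card_forests:
  assumes fin: "finite P" "finite Q" "finite A" "finite B"
    and disj: "P \<inter> A = {}" "Q \<inter> B = {}"
  shows "(card P + card A) * (card Q + card B) * card (forests P Q A B)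
    = (card P + card A) ^ card Q * (card Q + card B) ^ card P
      * (card A * card Q + card B * card P + card A * card B)"
proof -
  let ?p = "card P" and ?q = "card Q" and ?a = "card A" and ?b = "card B"
  let ?W = "\<Sum>I\<in>Pow P. ?b ^ card I * ?q ^ card (P - I)"
  let ?D = "\<Sum>I\<in>Pow P. card I * (?b ^ card I * ?q ^ card (P - I))"
  have layer: "(?p + ?a) * card (forests (P - I) Q (A \<union> I) {})
      = (?a + card I) * ?q ^ card (P - I) * (?p + ?a) ^ ?q" if "I \<subseteq> P" for I
  proof -
    have I: "finite I" "A \<inter> I = {}" "(P - I) \<inter> (A \<union> I) = {}"
      using that fin disj by (auto intro: finite_subset)
    then have *: "card (A \<union> I) = ?a + card I" "card (P - I) + (?a + card I) = ?p + ?a"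
      using fin that by (auto simp: card_Un_disjoint card_Diff_subset card_mono)
    show ?thesis
      using card_forests_one_sided[of "P - I" Q "A \<union> I"] fin I by (simp only: * finite_Diff finite_UnI)
  qed
  have "(?p + ?a) * card (forests P Q A B)
      = (\<Sum>I\<in>Pow P. ?b ^ card I * ((?p + ?a) * card (forests (P - I) Q (A \<union> I) {})))"
    by (simp add: card_forests_layer[OF fin disj(2)] sum_distrib_left mult.left_commute)
  also have "\<dots> = (\<Sum>I\<in>Pow P. (?p + ?a) ^ ?q * (?a * (?b ^ card I * ?q ^ card (P - I))
      + card I * (?b ^ card I * ?q ^ card (P - I))))"
  proof (rule sum.cong)
    fix I assume "I \<in> Pow P"
    then have "?b ^ card I * ((?p + ?a) * card (forests (P - I) Q (A \<union> I) {}))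
        = ?b ^ card I * ((?a + card I) * ?q ^ card (P - I) * (?p + ?a) ^ ?q)"
      by (simp only: layer Pow_iff)
    then show "?b ^ card I * ((?p + ?a) * card (forests (P - I) Q (A \<union> I) {}))
        = (?p + ?a) ^ ?q * (?a * (?b ^ card I * ?q ^ card (P - I))
          + card I * (?b ^ card I * ?q ^ card (P - I)))"
      by (simp only: algebra_simps)
  qed simp
  also have "\<dots> = (?p + ?a) ^ ?q * (?a * ?W + ?D)"
    by (simp only: sum_distrib_left[symmetric] sum.distrib)
  finally have "(?q + ?b) * ((?p + ?a) * card (forests P Q A B))
      = (?q + ?b) * ((?p + ?a) ^ ?q * (?a * ?W + ?D))"
    by simp
  then have "(?p + ?a) * (?q + ?b) * card (forests P Q A B)
      = (?p + ?a) ^ ?q * (?a * (?q + ?b) * ?W + (?b + ?q) * ?D)"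
    by (simp only: algebra_simps)
  also have "\<dots> = (?p + ?a) ^ ?q * (?q + ?b) ^ ?p * (?a * ?q + ?b * ?p + ?a * ?b)"
    unfolding sum_Pow_binomial_card[OF fin(1)] sum_Pow_binomial[OF fin(1)]
    by (simp add: algebra_simps)
  finally show ?thesis .
qed

section \<open>Eventually constant pairs as forests rooted at an edge\<close>

definition terminal_edge ::
  "'a set \<Rightarrow> 'b set \<Rightarrow> ('a \<Rightarrow> 'b) \<Rightarrow> ('b \<Rightarrow> 'a) \<Rightarrow> 'a \<Rightarrow> 'b \<Rightarrow> bool" where
  "terminal_edge X Y f g x y \<longleftrightarrow>
     x \<in> X \<and> y \<in> Y \<and> f x = y \<and> g y = x \<and> trap_free (X - {x}) (Y - {y}) f g"

text \<open>
  The constant value \<open>c\<close> of an iterate of \<open>g \<circ> f\<close> is a fixed point of \<open>g \<circ> f\<close>, because \<open>g \<circ> f\<close>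
  commutes with its iterates. A closed part avoiding \<open>c\<close> would be kept by the iterate, which
  sends everything to \<open>c\<close>.
\<close>

lemma eventually_constant_imp_terminal_edge:
  assumes f: "f \<in> X \<rightarrow>\<^sub>E Y" and g: "g \<in> Y \<rightarrow>\<^sub>E X" and "X \<noteq> {}"
    and "eventually_constant_on (g \<circ> f) X"
  shows "\<exists>x y. terminal_edge X Y f g x y"
proof -
  let ?h = "g \<circ> f"
  obtain k c where k: "\<And>x. x \<in> X \<Longrightarrow> (?h ^^ k) x = c"
    using assms(4) unfolding eventually_constant_on_def constant_on_def by blast
  have hX: "?h x \<in> X" if "x \<in> X" for x
    using f g that by auto
  have iter: "(?h ^^ i) x \<in> V" if "x \<in> V" "\<And>x. x \<in> V \<Longrightarrow> ?h x \<in> V" for i x V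
    using that by (induction i) auto
  obtain z where z: "z \<in> X"
    using assms(3) by blast
  have c: "c \<in> X"
    using iter[of z X k] z hX k[OF z] by simp
  have "?h c = ?h ((?h ^^ k) z)"
    using k[OF z] by simp
  also have "\<dots> = (?h ^^ k) (?h z)"
    by (simp only: funpow_swap1)
  also have "\<dots> = c"
    using k[OF hX[OF z]] .
  finally have "g (f c) = c"
    by simp
  moreover have "trap_free (X - {c}) (Y - {f c}) f g"
    unfolding trap_free_def
  proof (intro allI impI)
    fix V U assume VU: "V \<subseteq> X - {c}" "U \<subseteq> Y - {f c}" "f ` V \<subseteq> U" "g ` U \<subseteq> V"
    have V_step: "?h x \<in> V" if "x \<in> V" for x
      using VU(3,4) that by auto
    have "x \<notin> V" for x
    proof
      assume x: "x \<in> V"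
      then have "(?h ^^ k) x \<in> V"
        using V_step by (rule iter)
      then show False
        using k[of x] x VU(1) by auto
    qed
    then show "V = {} \<and> U = {}"
      using VU(4) by auto
  qed
  ultimately have "terminal_edge X Y f g c (f c)"
    using c f by (auto simp: terminal_edge_def)
  then show ?thesis
    by blast
qed

text \<open>
  The points of \<open>X\<close> whose orbit misses \<open>x0\<close> form, with their images, a closed part; hence there are
  none. As \<open>X\<close> is finite and \<open>x0\<close> is fixed by \<open>g \<circ> f\<close>, one common number of steps takes every
  point to \<open>x0\<close>.
\<close>

lemma terminal_edge_imp_eventually_constant:
  assumes f: "f \<in> X \<rightarrow>\<^sub>E Y" and g: "g \<in> Y \<rightarrow>\<^sub>E X" and "finite X"
    and edge: "terminal_edge X Y f g x0 y0"
  shows "\<exists>k>0. \<forall>x\<in>X. ((g \<circ> f) ^^ k) x = x0"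
proof -
  let ?h = "g \<circ> f"
  have e: "f x0 = y0" "g y0 = x0" "trap_free (X - {x0}) (Y - {y0}) f g"
    using edge by (auto simp: terminal_edge_def)
  define V where "V = {x \<in> X. \<forall>i. (?h ^^ i) x \<noteq> x0}"
  have V_step: "?h x \<in> V" if "x \<in> V" for x
  proof -
    have "(?h ^^ i) (?h x) \<noteq> x0" for i
      using that unfolding V_def by (metis (mono_tags, lifting) funpow_Suc_right comp_apply mem_Collect_eq)
    then show ?thesis
      using that f g by (auto simp: V_def)
  qed
  have V_x0: "x0 \<notin> V"
    unfolding V_def by (auto intro: exI[of _ 0])
  have "f ` V \<subseteq> Y - {y0}"
  proof clarsimp
    fix x assume x: "x \<in> V"
    then have "x \<in> X"
      by (simp add: V_def)
    moreover have "f x \<noteq> y0"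
      using V_step[OF x] V_x0 e(2) by auto
    ultimately show "f x \<in> Y \<and> f x \<noteq> y0"
      using f by auto
  qed
  moreover have "V \<subseteq> X - {x0}"
    using V_x0 by (auto simp: V_def)
  moreover have "g ` f ` V \<subseteq> V"
    using V_step by auto
  ultimately have "V = {}"
    using e(3) unfolding trap_free_def by blast
  then have "\<forall>x\<in>X. \<exists>i. (?h ^^ i) x = x0"
    by (auto simp: V_def)
  then obtain t where t: "\<And>x. x \<in> X \<Longrightarrow> (?h ^^ t x) x = x0"
    by metis
  have fixed: "(?h ^^ j) x0 = x0" for j
    using e by (induction j) auto
  \<comment> \<open>The sum is a common upper bound of all \<open>t x\<close>; the successor makes it positive.\<close>
  define k where "k = Suc (\<Sum>x\<in>X. t x)"
  have "(?h ^^ k) x = x0" if x: "x \<in> X" for x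
  proof -
    have "t x \<le> k"
      using member_le_sum[of x X t] x assms(3) by (simp add: k_def)
    then obtain j where "k = j + t x"
      by (metis le_add_diff_inverse2)
    then show ?thesis
      using t[OF x] fixed by (simp add: funpow_add)
  qed
  then show ?thesis
    by (intro exI[of _ k]) (auto simp: k_def)
qed

lemma eventually_constant_pair_iff_terminal_edge:
  assumes "finite X" "X \<noteq> {}"
  shows "eventually_constant_pair X Y f g \<longleftrightarrow>
    f \<in> X \<rightarrow>\<^sub>E Y \<and> g \<in> Y \<rightarrow>\<^sub>E X \<and> (\<exists>x\<in>X. \<exists>y\<in>Y. terminal_edge X Y f g x y)"
proof -
  have "eventually_constant_on (g \<circ> f) X"
    if "f \<in> X \<rightarrow>\<^sub>E Y" "g \<in> Y \<rightarrow>\<^sub>E X" "terminal_edge X Y f g x y" for x y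
    using terminal_edge_imp_eventually_constant[OF that(1,2) assms(1) that(3)]
    unfolding eventually_constant_on_def constant_on_def by blast
  then show ?thesis
    unfolding eventually_constant_pair_def
    using eventually_constant_imp_terminal_edge[of f X Y g] assms(2)
    by (auto simp: terminal_edge_def)
qed

text \<open>A second fixed point of \<open>g \<circ> f\<close> would not be moved to the eventual value.\<close>

lemma terminal_edge_unique:
  assumes "f \<in> X \<rightarrow>\<^sub>E Y" "g \<in> Y \<rightarrow>\<^sub>E X" "finite X"
    and "terminal_edge X Y f g x y" "terminal_edge X Y f g x' y'"
  shows "x = x' \<and> y = y'"
proof -
  obtain k where k: "\<forall>z\<in>X. ((g \<circ> f) ^^ k) z = x"
    using terminal_edge_imp_eventually_constant[OF assms(1-4)] by blast
  have "((g \<circ> f) ^^ j) x' = x'" for j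
    using assms(5) by (induction j) (auto simp: terminal_edge_def)
  then show ?thesis
    using k assms(4,5) by (auto simp: terminal_edge_def)
qed

lemma card_terminal_edge:
  assumes "x \<in> X" "y \<in> Y"
  shows "card {(f, g). f \<in> X \<rightarrow>\<^sub>E Y \<and> g \<in> Y \<rightarrow>\<^sub>E X \<and> terminal_edge X Y f g x y}
    = card (forests (X - {x}) (Y - {y}) {x} {y})"
proof (rule bij_betw_same_card)
  let ?S = "{(f, g). f \<in> X \<rightarrow>\<^sub>E Y \<and> g \<in> Y \<rightarrow>\<^sub>E X \<and> terminal_edge X Y f g x y}"
  let ?T = "forests (X - {x}) (Y - {y}) {x} {y}"
  let ?\<phi> = "\<lambda>(f, g). (restrict f (X - {x}), restrict g (Y - {y}))"
  let ?\<psi> = "\<lambda>(f, g). (f(x := y), g(y := x))"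
  have XY: "X - {x} \<union> {x} = X" "Y - {y} \<union> {y} = Y"
    using assms by auto
  show "bij_betw ?\<phi> ?S ?T"
  proof (rule bij_betw_byWitness[where f' = ?\<psi>])
    show "\<forall>a\<in>?S. ?\<psi> (?\<phi> a) = a"
      using assms by (auto simp: terminal_edge_def fun_eq_iff PiE_def extensional_def)
    show "\<forall>a\<in>?T. ?\<phi> (?\<psi> a) = a"
      by (auto simp: forests_def fun_eq_iff PiE_def extensional_def)
    show "?\<phi> ` ?S \<subseteq> ?T"
    proof clarify
      fix f g
      assume *: "f \<in> X \<rightarrow>\<^sub>E Y" "g \<in> Y \<rightarrow>\<^sub>E X" "terminal_edge X Y f g x y"
      have "trap_free (X - {x}) (Y - {y}) (restrict f (X - {x})) (restrict g (Y - {y}))"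
        using *(3) by (subst trap_free_cong[of _ _ f _ _ g]) (auto simp: terminal_edge_def)
      then show "(restrict f (X - {x}), restrict g (Y - {y})) \<in> ?T"
        using *(1,2) unfolding forests_def XY by auto
    qed
    show "?\<psi> ` ?T \<subseteq> ?S"
    proof clarify
      fix f g assume "(f, g) \<in> ?T"
      then have *: "f \<in> X - {x} \<rightarrow>\<^sub>E Y" "g \<in> Y - {y} \<rightarrow>\<^sub>E X" "trap_free (X - {x}) (Y - {y}) f g"
        unfolding forests_def XY by auto
      have "trap_free (X - {x}) (Y - {y}) (f(x := y)) (g(y := x))"
        using *(3) by (subst trap_free_cong[of _ _ f _ _ g]) auto
      then have "terminal_edge X Y (f(x := y)) (g(y := x)) x y"
        using assms by (simp add: terminal_edge_def)
      moreover have "f(x := y) \<in> X \<rightarrow>\<^sub>E Y" "g(y := x) \<in> Y \<rightarrow>\<^sub>E X"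
        using *(1,2) assms by (auto simp: PiE_iff extensional_def)
      ultimately show "f(x := y) \<in> X \<rightarrow>\<^sub>E Y \<and> g(y := x) \<in> Y \<rightarrow>\<^sub>E X
          \<and> terminal_edge X Y (f(x := y)) (g(y := x)) x y"
        by blast
    qed
  qed
qed

theorem theorem3p3:
  fixes X :: "'a set" and Y :: "'b set" and m n :: nat
  assumes "finite X" and "finite Y"
    and "card X = m" and "card Y = n"
    and "m \<ge> 1" and "n \<ge> 1"
  shows "card {(f, g). eventually_constant_pair X Y f g} = m ^ (n - 1) * n ^ (m - 1) * (m + n - 1)"
proof -
  let ?S = "\<lambda>(x, y). {(f, g). f \<in> X \<rightarrow>\<^sub>E Y \<and> g \<in> Y \<rightarrow>\<^sub>E X \<and> terminal_edge X Y f g x y}"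
  let ?R = "m ^ (n - 1) * n ^ (m - 1) * (m + n - 1)"
  have "X \<noteq> {}"
    using assms by auto
  have "{(f, g). eventually_constant_pair X Y f g} = (\<Union>e\<in>X \<times> Y. ?S e)"
    by (auto simp: eventually_constant_pair_iff_terminal_edge[OF assms(1) \<open>X \<noteq> {}\<close>])
  then have "card {(f, g). eventually_constant_pair X Y f g} = card (\<Union>e\<in>X \<times> Y. ?S e)"
    by simp
  also have "\<dots> = (\<Sum>e\<in>X \<times> Y. card (?S e))"
  proof (rule card_UN_disjoint)
    have "?S e \<subseteq> (X \<rightarrow>\<^sub>E Y) \<times> (Y \<rightarrow>\<^sub>E X)" for e
      by auto
    moreover have "finite ((X \<rightarrow>\<^sub>E Y) \<times> (Y \<rightarrow>\<^sub>E X))"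
      using assms by (intro finite_cartesian_product finite_PiE) auto
    ultimately show "\<forall>e\<in>X \<times> Y. finite (?S e)"
      using finite_subset by blast
    show "\<forall>e\<in>X \<times> Y. \<forall>e'\<in>X \<times> Y. e \<noteq> e' \<longrightarrow> ?S e \<inter> ?S e' = {}"
      using terminal_edge_unique[of _ X Y] assms(1) by fastforce
  qed (use assms in auto)
  finally have total: "card {(f, g). eventually_constant_pair X Y f g}
      = (\<Sum>e\<in>X \<times> Y. card (?S e))" .
  \<comment> \<open>All \<open>m * n\<close> edges contribute equally, so the factor \<open>m * n\<close> can be cancelled at the end.\<close>
  have "m * n * card (?S e) = ?R" if e: "e \<in> X \<times> Y" for e
  proof -
    obtain x y where xy: "e = (x, y)" "x \<in> X" "y \<in> Y"
      using e by auto
    let ?P = "X - {x}" and ?Q = "Y - {y}"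
    have PQ: "card ?P = m - 1" "card ?Q = n - 1"
      using assms xy by auto
    have ends: "card ?P + card {x} = m" "card ?Q + card {y} = n"
      "card {x} * card ?Q + card {y} * card ?P + card {x} * card {y} = m + n - 1"
      using assms(5,6) by (simp_all add: PQ)
    have "m * n * card (forests ?P ?Q {x} {y}) = m ^ card ?Q * n ^ card ?P * (m + n - 1)"
      using card_forests[of ?P ?Q "{x}" "{y}", unfolded ends] assms(1,2) by simp
    then show ?thesis
      using card_terminal_edge[OF xy(2,3)] by (simp add: xy(1) PQ)
  qed
  then have "m * n * (\<Sum>e\<in>X \<times> Y. card (?S e)) = (\<Sum>e\<in>X \<times> Y. ?R)"
    unfolding sum_distrib_left by (rule sum.cong[OF refl])
  also have "\<dots> = m * n * ?R"
    using assms by (simp add: card_cartesian_product)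
  finally show ?thesis
    using total assms by simp
qed

end
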